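(* Let $n,m\ge1$, let $B_0$ be an $n\times n$ complex matrix, let $B_1,\dots,B_m$ be $n\times n$ unitary matrices, and let $\alpha_1,\dots,\alpha_m$ be complex numbers with $|\alpha_1|<|\alpha_2|<\cdots<|\alpha_m|$. Let $$q(x)=x-\|B_0\|_2-\frac{\|B_1\|_2}{x-|\alpha_1|}-\cdots-\frac{\|B_m\|_2}{x-|\alpha_m|},$$ and let $R$ be the largest real root of $q(x)$. Then $$R\le\frac12\left(|\alpha_m|+\|B_0\|_2+\sqrt{(|\alpha_m|-\|B_0\|_2)^2+4m}\right).$$
   Context: $\|\cdot\|_2$ denotes the spectral norm of a square matrix. *)

theory Defs
  imports "HOL-Analysis.Analysis"
begin

definition conjugate_transpose :: "complex^'n^'m \<Rightarrow> complex^'m^'n" where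
  "conjugate_transpose A = map_matrix cnj (transpose A)"

definition unitary_matrix :: "complex^'n^'n \<Rightarrow> bool" where
  "unitary_matrix U \<longleftrightarrow>
     conjugate_transpose U ** U = mat 1 \<and> U ** conjugate_transpose U = mat 1"

text \<open>The norm of \<^typ>\<open>complex^'n\<close> is the Euclidean one, so \<^const>\<open>onorm\<close> gives the
  operator norm induced by the 2-norm.\<close>

definition spectral_norm :: "complex^'n^'n \<Rightarrow> real" where
  "spectral_norm A = onorm ((*v) A)"

definition q_fun :: "nat \<Rightarrow> (nat \<Rightarrow> complex^'n^'n) \<Rightarrow> (nat \<Rightarrow> complex) \<Rightarrow> real \<Rightarrow> real" where
  "q_fun m B \<alpha> x =
     x - spectral_norm (B 0) - (\<Sum>j=1..m. spectral_norm (B j) / (x - cmod (\<alpha> j)))"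

text \<open>The function \<open>q\<close> is undefined at the points \<open>\<bar>\<alpha>\<^sub>j\<bar>\<close>. They have to be excluded
  explicitly, because division by zero is total in HOL.\<close>

definition q_real_roots :: "nat \<Rightarrow> (nat \<Rightarrow> complex^'n^'n) \<Rightarrow> (nat \<Rightarrow> complex) \<Rightarrow> real set" where
  "q_real_roots m B \<alpha> = {x. (\<forall>j\<in>{1..m}. x \<noteq> cmod (\<alpha> j)) \<and> q_fun m B \<alpha> x = 0}"

end

theory Submission
  imports Defs
begin

text \<open>
  Write \<open>a = \<bar>\<alpha>\<^sub>m\<bar>\<close> and \<open>b\<close> for the spectral norm of \<open>B\<^sub>0\<close>. The right-hand side of the
  bound is the larger root of the quadratic \<open>(x - a) (x - b) = m\<close>, and it is at least \<open>a\<close>.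
  So let \<open>R > a\<close>. Unitary matrices preserve the Euclidean norm, which makes every numerator
  in \<open>q\<close> at most 1 (\<open>spectral_norm_unitary_le\<close>); and \<open>a\<close> is the largest of the poles, so
  every denominator \<open>R - \<bar>\<alpha>\<^sub>j\<bar>\<close> is at least \<open>R - a > 0\<close>. The equation \<open>q(R) = 0\<close> then gives
  \<open>R - b \<le> m / (R - a)\<close>, that is \<open>(R - a) (R - b) \<le> m\<close>, and this confines \<open>R\<close> to lie
  below the larger root (\<open>le_larger_root\<close>).
\<close>

lemma conjugate_transpose_adjoint:
  fixes A :: "complex^'n^'m"
  shows "(\<Sum>i\<in>UNIV. cnj ((A *v x) $ i) * y $ i)
       = (\<Sum>j\<in>UNIV. cnj (x $ j) * (conjugate_transpose A *v y) $ j)"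
proof -
  have "(\<Sum>i\<in>UNIV. cnj ((A *v x) $ i) * y $ i)
      = (\<Sum>i\<in>UNIV. \<Sum>j\<in>UNIV. cnj (x $ j) * (cnj (A $ i $ j) * y $ i))"
    by (simp add: matrix_vector_mult_def sum_distrib_left sum_distrib_right mult_ac)
  also have "\<dots> = (\<Sum>j\<in>UNIV. \<Sum>i\<in>UNIV. cnj (x $ j) * (cnj (A $ i $ j) * y $ i))"
    by (rule sum.swap)
  finally show ?thesis
    by (simp add: conjugate_transpose_def matrix_vector_mult_def map_matrix_def
        transpose_def sum_distrib_left)
qed

lemma of_real_norm_squared_vec:
  fixes x :: "complex^'n"
  shows "complex_of_real ((norm x)\<^sup>2) = (\<Sum>i\<in>UNIV. cnj (x $ i) * x $ i)"
proof -
  have "(norm x)\<^sup>2 = (\<Sum>i\<in>UNIV. (cmod (x $ i))\<^sup>2)"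
    by (simp add: norm_vec_def L2_set_def sum_nonneg)
  then show ?thesis
    by (simp add: complex_norm_square mult.commute del: of_real_power)
qed

lemma norm_unitary_mult_vec:
  assumes "unitary_matrix U"
  shows "norm (U *v x) = norm x"
proof -
  have "conjugate_transpose U *v (U *v x) = x"
    using assms by (simp add: unitary_matrix_def matrix_vector_mul_assoc)
  then have "complex_of_real ((norm (U *v x))\<^sup>2) = complex_of_real ((norm x)\<^sup>2)"
    unfolding of_real_norm_squared_vec conjugate_transpose_adjoint by simp
  then have "(norm (U *v x))\<^sup>2 = (norm x)\<^sup>2"
    by (simp only: of_real_eq_iff)
  then show ?thesis
    by simp
qed

lemma spectral_norm_unitary_le:
  assumes "unitary_matrix U"
  shows "spectral_norm U \<le> 1"
  unfolding spectral_norm_def by (rule onorm_le) (simp add: norm_unitary_mult_vec assms)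

text \<open>Completing the square: \<open>(x - a) (x - b) \<le> c\<close> says that
  \<open>(2 * x - a - b)\<^sup>2 \<le> (a - b)\<^sup>2 + 4 * c\<close>.\<close>

lemma le_larger_root:
  fixes a b c x :: real
  assumes "(x - a) * (x - b) \<le> c"
  shows "x \<le> (1/2) * (a + b + sqrt ((a - b)\<^sup>2 + 4 * c))"
proof -
  have "(2 * x - a - b)\<^sup>2 = (a - b)\<^sup>2 + 4 * ((x - a) * (x - b))"
    by (simp add: power2_eq_square algebra_simps)
  also have "\<dots> \<le> (a - b)\<^sup>2 + 4 * c"
    using assms by simp
  finally have "2 * x - a - b \<le> sqrt ((a - b)\<^sup>2 + 4 * c)"
    by (rule real_le_rsqrt)
  then show ?thesis
    by simp
qed

theorem theorem2p11:
  fixes m :: nat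
    and B :: "nat \<Rightarrow> complex^'n^'n"
    and \<alpha> :: "nat \<Rightarrow> complex"
    and R :: real
  assumes "m \<ge> 1"
    and "\<And>j. j \<in> {1..m} \<Longrightarrow> unitary_matrix (B j)"
    and "strict_mono_on {1..m} (\<lambda>j. cmod (\<alpha> j))"
    and "R \<in> q_real_roots m B \<alpha>"
    and "\<And>r. r \<in> q_real_roots m B \<alpha> \<Longrightarrow> r \<le> R"
  shows "R \<le> (1/2) * (cmod (\<alpha> m) + spectral_norm (B 0)
           + sqrt ((cmod (\<alpha> m) - spectral_norm (B 0))^2 + 4 * real m))"
proof (cases "R \<le> cmod (\<alpha> m)")
  case True
  (* At the point cmod (\<alpha> m) the quadratic vanishes, so the same criterion applies there. *)
  moreover have "cmod (\<alpha> m) \<le> (1/2) * (cmod (\<alpha> m) + spectral_norm (B 0)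
           + sqrt ((cmod (\<alpha> m) - spectral_norm (B 0))^2 + 4 * real m))"
    by (rule le_larger_root) simp
  ultimately show ?thesis
    by (rule order_trans)
next
  case False
  then have pos: "R - cmod (\<alpha> m) > 0"
    by simp
  have term_le: "spectral_norm (B j) / (R - cmod (\<alpha> j)) \<le> 1 / (R - cmod (\<alpha> m))"
    if j: "j \<in> {1..m}" for j
  proof -
    have "cmod (\<alpha> j) \<le> cmod (\<alpha> m)"
      using strict_mono_on_leD[OF assms(3) j, of m] j by simp
    then show ?thesis
      using pos spectral_norm_unitary_le[OF assms(2)[OF j]] by (intro frac_le) auto
  qed
  have "R - spectral_norm (B 0) = (\<Sum>j=1..m. spectral_norm (B j) / (R - cmod (\<alpha> j)))"
    using assms(4) by (simp add: q_real_roots_def q_fun_def)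
  also have "\<dots> \<le> (\<Sum>j=1..m. 1 / (R - cmod (\<alpha> m)))"
    by (intro sum_mono term_le)
  also have "\<dots> = real m / (R - cmod (\<alpha> m))"
    by simp
  finally have "(R - cmod (\<alpha> m)) * (R - spectral_norm (B 0)) \<le> real m"
    using pos by (simp add: field_simps)
  then show ?thesis
    by (rule le_larger_root)
qed

end
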